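(* Let $\mathrm{GL}(2)\times\mathrm{GL}(2)\times\mathrm{GL}(2)$ act on $\mathbb{R}^{2\times2\times2}$ by $(U,V,W)\cdot\mathcal{T}=\mathcal{T}\times_1U\times_2V\times_3W$, and let $D_0,D_1,D_2,D_2',D_2'',D_3,G_2,G_3$ be the eight orbits of the canonical forms listed in the context. For orbits $A,B$ write $A\preceq B$ if $\overline{A}\subseteq\overline{B}$ (closures in the Euclidean topology). Then $\preceq$ is a partial order on the set of these eight orbits, and its covering relations (the edges of its Hasse diagram) are exactly $$D_0\prec D_1;\qquad D_1\prec D_2,\quad D_1\prec D_2',\quad D_1\prec D_2'';\qquad D_2\prec D_3,\quad D_2'\prec D_3,\quad D_2''\prec D_3;\qquad D_3\prec G_2,\quad D_3\prec G_3.$$ Equivalently, $A\preceq B$ holds for two of these orbits if and only if $A=B$ or $A\preceq B$ follows from the listed relations by transitivity.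
   Context: A tensor $\mathcal{T}\in\mathbb{R}^{2\times2\times2}$ has real entries $t_{ijk}$, $i,j,k\in\{1,2\}$, and $\mathbb{R}^{2\times2\times2}\cong\mathbb{R}^8$ carries the Euclidean topology. For real $2\times 2$ matrices $U,V,W$, the tensor $\mathcal{S}=\mathcal{T}\times_1U\times_2V\times_3W$ has entries $s_{\alpha\beta\gamma}=\sum_{i,j,k=1}^2 t_{ijk}u_{\alpha i}v_{\beta j}w_{\gamma k}$. $\mathrm{GL}(2)$ denotes the group of invertible real $2\times2$ matrices. Let $\mathcal{E}_{ijk}\in\mathbb{R}^{2\times2\times2}$ be the tensor with a $1$ in position $(i,j,k)$ and zeros elsewhere. The eight orbits are the orbits, under the action $(U,V,W)\cdot\mathcal{T}=\mathcal{T}\times_1U\times_2V\times_3W$ of $\mathrm{GL}(2)\times\mathrm{GL}(2)\times\mathrm{GL}(2)$ on $\mathbb{R}^{2\times2\times2}$, of the following canonical forms: - $D_0$: the zero tensor; - $D_1$: $\mathcal{E}_{111}$; - $D_2$: $\mathcal{E}_{111}+\mathcal{E}_{221}$; - $D_2'$: $\mathcal{E}_{111}+\mathcal{E}_{122}$; - $D_2''$: $\mathcal{E}_{111}+\mathcal{E}_{212}$; - $D_3$: $\mathcal{E}_{111}+\mathcal{E}_{122}+\mathcal{E}_{212}$; - $G_2$: $\mathcal{E}_{111}+\mathcal{E}_{222}$; - $G_3$: $\mathcal{E}_{111}+\mathcal{E}_{221}-\mathcal{E}_{122}+\mathcal{E}_{212}$. It is a previously known fact that these eight orbits are pairwise distinct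 and partition $\mathbb{R}^{2\times2\times2}$. The Hasse diagram of a finite partially ordered set is the directed graph of its covering relations: strict relations $A\prec B$ with no element strictly between $A$ and $B$. *)

theory Defs
  imports "HOL-Analysis.Analysis"
begin

(* Both index values of the type 2 are written 1 and 2; in that type 2 = 0, so they are
   distinct and UNIV = {1, 2}.  The instance topology on real^2^2^2 is the Euclidean one. *)
type_synonym tensor = "real^2^2^2"

definition multilinear_mult :: "tensor \<Rightarrow> real^2^2 \<Rightarrow> real^2^2 \<Rightarrow> real^2^2 \<Rightarrow> tensor" where
  "multilinear_mult T U V W =
     (\<chi> a b c. \<Sum>i\<in>UNIV. \<Sum>j\<in>UNIV. \<Sum>k\<in>UNIV.
        T $ i $ j $ k * U $ a $ i * V $ b $ j * W $ c $ k)"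

definition unit_tensor :: "2 \<Rightarrow> 2 \<Rightarrow> 2 \<Rightarrow> tensor" where
  "unit_tensor i j k = (\<chi> a b c. if a = i \<and> b = j \<and> c = k then 1 else 0)"

definition GL_orbit :: "tensor \<Rightarrow> tensor set" where
  "GL_orbit T = {multilinear_mult T U V W | U V W. invertible U \<and> invertible V \<and> invertible W}"

definition D0 :: "tensor set" where
  "D0 = GL_orbit 0"

definition D1 :: "tensor set" where
  "D1 = GL_orbit (unit_tensor 1 1 1)"

definition D2 :: "tensor set" where
  "D2 = GL_orbit (unit_tensor 1 1 1 + unit_tensor 2 2 1)"

definition D2' :: "tensor set" where
  "D2' = GL_orbit (unit_tensor 1 1 1 + unit_tensor 1 2 2)"

definition D2'' :: "tensor set" where
  "D2'' = GL_orbit (unit_tensor 1 1 1 + unit_tensor 2 1 2)"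

definition D3 :: "tensor set" where
  "D3 = GL_orbit (unit_tensor 1 1 1 + unit_tensor 1 2 2 + unit_tensor 2 1 2)"

definition G2 :: "tensor set" where
  "G2 = GL_orbit (unit_tensor 1 1 1 + unit_tensor 2 2 2)"

definition G3 :: "tensor set" where
  "G3 = GL_orbit (unit_tensor 1 1 1 + unit_tensor 2 2 1 - unit_tensor 1 2 2 + unit_tensor 2 1 2)"

definition eight_orbits :: "tensor set set" where
  "eight_orbits = {D0, D1, D2, D2', D2'', D3, G2, G3}"

definition degen_order :: "(tensor set \<times> tensor set) set" where
  "degen_order = {(A, B). A \<in> eight_orbits \<and> B \<in> eight_orbits \<and> closure A \<subseteq> closure B}"

definition covering_relations :: "('a \<times> 'a) set \<Rightarrow> ('a \<times> 'a) set" where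
  "covering_relations r =
     {(a, b). (a, b) \<in> r \<and> a \<noteq> b \<and>
        \<not> (\<exists>c. (a, c) \<in> r \<and> a \<noteq> c \<and> (c, b) \<in> r \<and> c \<noteq> b)}"

definition hasse_edges :: "(tensor set \<times> tensor set) set" where
  "hasse_edges =
     {(D0, D1),
      (D1, D2), (D1, D2'), (D1, D2''),
      (D2, D3), (D2', D3), (D2'', D3),
      (D3, G2), (D3, G3)}"

end

theory Submission
  imports Defs
begin

text \<open>
  Since the group acts by homeomorphisms, \<open>closure A \<subseteq> closure B\<close> holds as soon as one point
  of the orbit \<open>A\<close> is a limit of points of \<open>B\<close>; each listed edge comes from an explicit
  one-parameter family in \<open>B\<close> that degenerates at \<open>t = 0\<close>. All other relations are excluded by
  closed invariant sets: the zero tensor, the tensors for which a given one of the three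
  flattenings has rank at most one, and the tensors with nonnegative or nonpositive Cayley
  hyperdeterminant. These sets also separate the eight orbits.
\<close>

section \<open>The action, composed and split into single modes\<close>

abbreviation mat22 :: "real \<Rightarrow> real \<Rightarrow> real \<Rightarrow> real \<Rightarrow> real^2^2" where
  "mat22 a b c d \<equiv> vector [vector [a, b], vector [c, d]]"

lemma invertible_mat22: "invertible (mat22 a b c d) \<longleftrightarrow> a * d \<noteq> b * c"
  by (simp add: invertible_det_nz det_2)

lemma multilinear_mult_compose:
  "multilinear_mult (multilinear_mult T U V W) U' V' W' =
     multilinear_mult T (U' ** U) (V' ** V) (W' ** W)"
  by (simp add: multilinear_mult_def vec_eq_iff sum_2 matrix_matrix_mult_def algebra_simps)

text \<open>Reduces invariance under the action to transformations of one mode at a time.\<close>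

lemma multilinear_mult_modes:
  "multilinear_mult T U V W =
     multilinear_mult (multilinear_mult (multilinear_mult T U (mat 1) (mat 1))
       (mat 1) V (mat 1)) (mat 1) (mat 1) W"
  by (simp add: multilinear_mult_compose)

text \<open>Identity matrices collapse two of the three sums. In each equation \<open>a\<close> is
  the transformed index, so that proofs for the three modes share one shape.\<close>

lemma multilinear_mult_mode_nth:
  "multilinear_mult T U (mat 1) (mat 1) $ a $ b $ c = T $ 1 $ b $ c * U $ a $ 1 + T $ 2 $ b $ c * U $ a $ 2"
  "multilinear_mult T (mat 1) U (mat 1) $ b $ a $ c = T $ b $ 1 $ c * U $ a $ 1 + T $ b $ 2 $ c * U $ a $ 2"
  "multilinear_mult T (mat 1) (mat 1) U $ b $ c $ a = T $ b $ c $ 1 * U $ a $ 1 + T $ b $ c $ 2 * U $ a $ 2"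
  using exhaust_2[of b] exhaust_2[of c]
  by (auto simp: multilinear_mult_def sum_2 mat_def)

lemma continuous_on_multilinear_mult:
  "continuous_on A (\<lambda>T. multilinear_mult T U V W)"
  unfolding multilinear_mult_def by (intro continuous_intros)

section \<open>Orbits, their limits, and closed invariant sets\<close>

lemma GL_orbit_self: "T \<in> GL_orbit T"
proof -
  have "multilinear_mult T (mat 1) (mat 1) (mat 1) = T"
    using multilinear_mult_mode_nth(1)[of T "mat 1"]
    by (simp add: vec_eq_iff forall_2 mat_def)
  then show ?thesis
    unfolding GL_orbit_def mem_Collect_eq
    by (intro exI[of _ "mat 1"]) (simp add: invertible_det_nz)
qed

lemma GL_orbit_mult:
  assumes "S \<in> GL_orbit T" "invertible U" "invertible V" "invertible W"
  shows "multilinear_mult S U V W \<in> GL_orbit T"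
proof -
  obtain U' V' W' where "S = multilinear_mult T U' V' W'"
    and "invertible U'" "invertible V'" "invertible W'"
    using assms(1) unfolding GL_orbit_def by auto
  then have "multilinear_mult S U V W = multilinear_mult T (U ** U') (V ** V') (W ** W')"
    and "invertible (U ** U')" "invertible (V ** V')" "invertible (W ** W')"
    using assms(2-4) by (simp_all add: multilinear_mult_compose invertible_mult)
  then show ?thesis unfolding GL_orbit_def by blast
qed

text \<open>A fixed invertible triple acts continuously and maps the orbit of \<open>T\<close> into
  itself, hence also its closure. So this closure contains the whole orbit of each of its
  points.\<close>

lemma closure_GL_orbit_mono:
  assumes "S \<in> closure (GL_orbit T)"
  shows "closure (GL_orbit S) \<subseteq> closure (GL_orbit T)"
proof (rule closure_minimal)
  show "GL_orbit S \<subseteq> closure (GL_orbit T)"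
  proof
    fix R assume "R \<in> GL_orbit S"
    then obtain U V W where R: "R = multilinear_mult S U V W"
      and inv: "invertible U" "invertible V" "invertible W"
      unfolding GL_orbit_def by auto
    have "(\<lambda>T. multilinear_mult T U V W) ` closure (GL_orbit T) \<subseteq> closure (GL_orbit T)"
      using GL_orbit_mult[OF _ inv] closure_subset[of "GL_orbit T"]
      by (intro image_closure_subset continuous_on_multilinear_mult) auto
    then show "R \<in> closure (GL_orbit T)" using R assms by auto
  qed
qed simp

lemma closure_GL_orbit_subsetI:
  assumes "isCont f (0::real)" and "\<And>t. t \<noteq> 0 \<Longrightarrow> f t \<in> GL_orbit T"
  shows "closure (GL_orbit (f 0)) \<subseteq> closure (GL_orbit T)"
proof (rule closure_GL_orbit_mono)
  show "f 0 \<in> closure (GL_orbit T)"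
  proof (rule Lim_in_closed_set)
    show "\<forall>\<^sub>F t in at 0. f t \<in> closure (GL_orbit T)"
      \<comment> \<open>The filter \<open>at 0\<close> ignores the point 0 itself, so
        \<open>f 0\<close> may lie outside the orbit.\<close>
      unfolding eventually_at_filter
      using assms(2) closure_subset[of "GL_orbit T"] by (intro always_eventually) auto
    show "(f \<longlongrightarrow> f 0) (at 0)" using assms(1) by (simp add: isCont_def)
  qed auto
qed

text \<open>The obstruction to degeneration: \<open>F\<close> traps the orbit of \<open>T\<close>
  and, being closed, its limits. Each mode is tested with every matrix, singular ones
  included.\<close>

lemma closed_invariant_closure_GL_orbit:
  assumes "closed F" and "T \<in> F"
    and "\<And>R U. R \<in> F \<Longrightarrow> multilinear_mult R U (mat 1) (mat 1) \<in> F"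
    and "\<And>R U. R \<in> F \<Longrightarrow> multilinear_mult R (mat 1) U (mat 1) \<in> F"
    and "\<And>R U. R \<in> F \<Longrightarrow> multilinear_mult R (mat 1) (mat 1) U \<in> F"
    and "closure (GL_orbit S) \<subseteq> closure (GL_orbit T)"
  shows "S \<in> F"
proof -
  have "GL_orbit T \<subseteq> F"
    unfolding GL_orbit_def using assms(2-5) by (subst multilinear_mult_modes) auto
  then have "closure (GL_orbit T) \<subseteq> F" using assms(1) by (rule closure_minimal)
  then show ?thesis using assms(6) GL_orbit_self[of S] closure_subset[of "GL_orbit S"] by blast
qed

section \<open>Flattening minors and the hyperdeterminant\<close>

text \<open>The predicates \<open>flat1\<close>, \<open>flat2\<close>, \<open>flat3\<close> say that all \<open>2 \<times> 2\<close> minors of the flattening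
  along the respective mode vanish.\<close>

definition flat1 :: "tensor \<Rightarrow> bool" where
  "flat1 T \<longleftrightarrow> (\<forall>i i' j j' k k'. T$i$j$k * T$i'$j'$k' = T$i'$j$k * T$i$j'$k')"

definition flat2 :: "tensor \<Rightarrow> bool" where
  "flat2 T \<longleftrightarrow> (\<forall>i i' j j' k k'. T$i$j$k * T$i'$j'$k' = T$i$j'$k * T$i'$j$k')"

definition flat3 :: "tensor \<Rightarrow> bool" where
  "flat3 T \<longleftrightarrow> (\<forall>i i' j j' k k'. T$i$j$k * T$i'$j'$k' = T$i$j$k' * T$i'$j'$k)"

text \<open>For the frontal slices \<open>A\<close>, \<open>B\<close> of a tensor, \<open>det (x A + y B)\<close> is the binary quadratic form
  \<open>pencil11 x\<^sup>2 + pencil12 x y + pencil22 y\<^sup>2\<close>, whose discriminant is the Cayley hyperdeterminant.\<close>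

definition pencil11 :: "tensor \<Rightarrow> real" where
  "pencil11 T = T$1$1$1 * T$2$2$1 - T$1$2$1 * T$2$1$1"

definition pencil12 :: "tensor \<Rightarrow> real" where
  "pencil12 T = T$1$1$1 * T$2$2$2 + T$2$2$1 * T$1$1$2 - T$1$2$1 * T$2$1$2 - T$2$1$1 * T$1$2$2"

definition pencil22 :: "tensor \<Rightarrow> real" where
  "pencil22 T = T$1$1$2 * T$2$2$2 - T$1$2$2 * T$2$1$2"

definition hyperdet :: "tensor \<Rightarrow> real" where
  "hyperdet T = (pencil12 T)\<^sup>2 - 4 * pencil11 T * pencil22 T"

lemmas pencil_defs = pencil11_def pencil12_def pencil22_def

text \<open>For a matrix acting in a mode other than that of the flattening: the new minor is a
  bilinear combination of old ones, whose vanishing is expressed by the four hypotheses.\<close>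

lemma mult_sum_cong:
  fixes p :: real
  assumes "p * r = p' * r'" "p * s = p' * s'" "q * r = q' * r'" "q * s = q' * s'"
  shows "(p * x + q * y) * (r * z + s * w) = (p' * x + q' * y) * (r' * z + s' * w)"
proof -
  have *: "(p * x + q * y) * (r * z + s * w) =
      (p * r) * (x * z) + (p * s) * (x * w) + (q * r) * (y * z) + (q * s) * (y * w)"
    for p q r s :: real by (simp add: algebra_simps)
  show ?thesis by (simp only: * assms)
qed

text \<open>For a matrix acting in the mode of the flattening itself: the two sides differ by
  \<open>(p * s - q * r) * (x * w - y * z)\<close>, an old minor times a determinant.\<close>

lemma mult_sum_swap:
  fixes p :: real
  assumes "p * s = q * r"
  shows "(p * x + q * y) * (r * z + s * w) = (p * z + q * w) * (r * x + s * y)"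
proof -
  have *: "(p * x + q * y) * (r * z + s * w) =
      (p * r) * (x * z) + (p * s) * (x * w) + (q * r) * (y * z) + (q * s) * (y * w)"
    for x y z w by (simp add: algebra_simps)
  show ?thesis by (simp add: * assms mult_ac)
qed

lemma flat1_mode:
  assumes "flat1 T"
  shows "flat1 (multilinear_mult T U (mat 1) (mat 1))"
    "flat1 (multilinear_mult T (mat 1) U (mat 1))"
    "flat1 (multilinear_mult T (mat 1) (mat 1) U)"
  using assms unfolding flat1_def multilinear_mult_mode_nth
  by (intro allI mult_sum_swap mult_sum_cong; blast)+

lemma flat2_mode:
  assumes "flat2 T"
  shows "flat2 (multilinear_mult T U (mat 1) (mat 1))"
    "flat2 (multilinear_mult T (mat 1) U (mat 1))"
    "flat2 (multilinear_mult T (mat 1) (mat 1) U)"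
  using assms unfolding flat2_def multilinear_mult_mode_nth
  by (intro allI mult_sum_swap mult_sum_cong; blast)+

lemma flat3_mode:
  assumes "flat3 T"
  shows "flat3 (multilinear_mult T U (mat 1) (mat 1))"
    "flat3 (multilinear_mult T (mat 1) U (mat 1))"
    "flat3 (multilinear_mult T (mat 1) (mat 1) U)"
  using assms unfolding flat3_def multilinear_mult_mode_nth
  by (intro allI mult_sum_swap mult_sum_cong; blast)+

lemma closed_flat: "closed {T. flat1 T}" "closed {T. flat2 T}" "closed {T. flat3 T}"
  unfolding flat1_def flat2_def flat3_def
  by (intro closed_Collect_all closed_Collect_eq continuous_intros)+

lemma continuous_on_hyperdet: "continuous_on A hyperdet"
  unfolding hyperdet_def pencil_defs by (intro continuous_intros)

text \<open>Modes 1 and 2 multiply both slices by \<open>U\<close> from the left or by its transpose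
  from the right, which scales the form by \<open>det U\<close>. Mode 3 recombines the slices, a
  linear substitution in x and y.\<close>

lemma pencil_mode:
  "pencil11 (multilinear_mult T U (mat 1) (mat 1)) = det U * pencil11 T"
  "pencil12 (multilinear_mult T U (mat 1) (mat 1)) = det U * pencil12 T"
  "pencil22 (multilinear_mult T U (mat 1) (mat 1)) = det U * pencil22 T"
  "pencil11 (multilinear_mult T (mat 1) U (mat 1)) = det U * pencil11 T"
  "pencil12 (multilinear_mult T (mat 1) U (mat 1)) = det U * pencil12 T"
  "pencil22 (multilinear_mult T (mat 1) U (mat 1)) = det U * pencil22 T"
  "pencil11 (multilinear_mult T (mat 1) (mat 1) U) =
     pencil11 T * (U$1$1)\<^sup>2 + pencil12 T * (U$1$1 * U$1$2) + pencil22 T * (U$1$2)\<^sup>2"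
  "pencil12 (multilinear_mult T (mat 1) (mat 1) U) =
     2 * pencil11 T * (U$1$1 * U$2$1) + pencil12 T * (U$1$1 * U$2$2 + U$1$2 * U$2$1)
     + 2 * pencil22 T * (U$1$2 * U$2$2)"
  "pencil22 (multilinear_mult T (mat 1) (mat 1) U) =
     pencil11 T * (U$2$1)\<^sup>2 + pencil12 T * (U$2$1 * U$2$2) + pencil22 T * (U$2$2)\<^sup>2"
  unfolding pencil_defs multilinear_mult_mode_nth det_2
  by (simp_all add: algebra_simps power2_eq_square)

text \<open>A discriminant is quadratic in the coefficients and gains the squared determinant under
  a linear substitution. As the factor is a square, both weak sign conditions on
  \<open>hyperdet\<close> persist even for singular \<open>U\<close>.\<close>

lemma hyperdet_mode:
  "hyperdet (multilinear_mult T U (mat 1) (mat 1)) = (det U)\<^sup>2 * hyperdet T"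
  "hyperdet (multilinear_mult T (mat 1) U (mat 1)) = (det U)\<^sup>2 * hyperdet T"
  "hyperdet (multilinear_mult T (mat 1) (mat 1) U) = (det U)\<^sup>2 * hyperdet T"
  by (simp_all add: hyperdet_def pencil_mode det_2 algebra_simps power2_eq_square)

lemma closure_GL_orbit_subsetD:
  assumes sub: "closure (GL_orbit S) \<subseteq> closure (GL_orbit T)"
  shows "T = 0 \<Longrightarrow> S = 0"
    and "flat1 T \<Longrightarrow> flat1 S" and "flat2 T \<Longrightarrow> flat2 S" and "flat3 T \<Longrightarrow> flat3 S"
    and "hyperdet T \<ge> 0 \<Longrightarrow> hyperdet S \<ge> 0" and "hyperdet T \<le> 0 \<Longrightarrow> hyperdet S \<le> 0"
proof -
  show "S = 0" if "T = 0"
    using closed_invariant_closure_GL_orbit[OF _ _ _ _ _ sub, of "{0}"] that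
    by (simp add: vec_eq_iff multilinear_mult_mode_nth)
  show "flat1 S" if "flat1 T"
    using closed_invariant_closure_GL_orbit[OF closed_flat(1) _ _ _ _ sub] that flat1_mode by simp
  show "flat2 S" if "flat2 T"
    using closed_invariant_closure_GL_orbit[OF closed_flat(2) _ _ _ _ sub] that flat2_mode by simp
  show "flat3 S" if "flat3 T"
    using closed_invariant_closure_GL_orbit[OF closed_flat(3) _ _ _ _ sub] that flat3_mode by simp
  have "closed {T. 0 \<le> hyperdet T}" "closed {T. hyperdet T \<le> 0}"
    by (intro closed_Collect_le continuous_on_hyperdet continuous_on_const)+
  note sublevel = closed_invariant_closure_GL_orbit[OF this(1) _ _ _ _ sub]
    closed_invariant_closure_GL_orbit[OF this(2) _ _ _ _ sub]
  show "hyperdet S \<ge> 0" if "hyperdet T \<ge> 0"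
    using sublevel(1) that by (simp add: hyperdet_mode)
  show "hyperdet S \<le> 0" if "hyperdet T \<le> 0"
    using sublevel(2) that by (simp add: hyperdet_mode mult_nonneg_nonpos)
qed

section \<open>Invariants of the canonical forms\<close>

lemma invariants_zero [simp]: "flat1 0" "flat2 0" "flat3 0" "hyperdet 0 = 0"
  by (simp_all add: flat1_def flat2_def flat3_def hyperdet_def pencil_defs)

lemmas invariant_simps = flat1_def flat2_def flat3_def hyperdet_def pencil_defs forall_2 unit_tensor_def

lemma invariants_D1 [simp]:
  defines "T \<equiv> unit_tensor 1 1 1"
  shows "T \<noteq> 0" "flat1 T" "flat2 T" "flat3 T" "hyperdet T = 0"
  by (simp_all add: T_def invariant_simps vec_eq_iff)

text \<open>Each of \<open>D2\<close>, \<open>D2'\<close>, \<open>D2''\<close> has exactly one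
  flattening of rank at most one, a different one each time; this makes them pairwise
  incomparable.\<close>

lemma invariants_D2 [simp]:
  defines "T \<equiv> unit_tensor 1 1 1 + unit_tensor 2 2 1"
  shows "T \<noteq> 0" "\<not> flat1 T" "\<not> flat2 T" "flat3 T" "hyperdet T = 0"
  by (simp_all add: T_def invariant_simps vec_eq_iff)

lemma invariants_D2' [simp]:
  defines "T \<equiv> unit_tensor 1 1 1 + unit_tensor 1 2 2"
  shows "T \<noteq> 0" "flat1 T" "\<not> flat2 T" "\<not> flat3 T" "hyperdet T = 0"
  by (simp_all add: T_def invariant_simps vec_eq_iff)

lemma invariants_D2'' [simp]:
  defines "T \<equiv> unit_tensor 1 1 1 + unit_tensor 2 1 2"
  shows "T \<noteq> 0" "\<not> flat1 T" "flat2 T" "\<not> flat3 T" "hyperdet T = 0"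
  by (simp_all add: T_def invariant_simps vec_eq_iff)

text \<open>The form \<open>det (x A + y B)\<close> is \<open>-y^2\<close> here, with a double root;
  it is \<open>x y\<close> for \<open>G2\<close>, with two real roots, and \<open>x^2 + y^2\<close>
  for \<open>G3\<close>, with none.\<close>

lemma invariants_D3 [simp]:
  defines "T \<equiv> unit_tensor 1 1 1 + unit_tensor 1 2 2 + unit_tensor 2 1 2"
  shows "T \<noteq> 0" "\<not> flat1 T" "\<not> flat2 T" "\<not> flat3 T" "hyperdet T = 0"
  by (simp_all add: T_def invariant_simps vec_eq_iff)

lemma invariants_G2 [simp]:
  defines "T \<equiv> unit_tensor 1 1 1 + unit_tensor 2 2 2"
  shows "T \<noteq> 0" "\<not> flat1 T" "\<not> flat2 T" "\<not> flat3 T" "hyperdet T = 1"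
  by (simp_all add: T_def invariant_simps vec_eq_iff)

lemma invariants_G3 [simp]:
  defines "T \<equiv> unit_tensor 1 1 1 + unit_tensor 2 2 1 - unit_tensor 1 2 2 + unit_tensor 2 1 2"
  shows "T \<noteq> 0" "\<not> flat1 T" "\<not> flat2 T" "\<not> flat3 T" "hyperdet T = -4"
  by (simp_all add: T_def invariant_simps vec_eq_iff)

section \<open>Degenerations along the nine edges\<close>

lemma closure_GL_orbit_degeneration:
  assumes "isCont f (0::real)" "f 0 = S"
    and "\<And>t. t \<noteq> 0 \<Longrightarrow> f t = multilinear_mult T (U t) (V t) (W t)"
    and "\<And>t. t \<noteq> 0 \<Longrightarrow> invertible (U t) \<and> invertible (V t) \<and> invertible (W t)"
  shows "closure (GL_orbit S) \<subseteq> closure (GL_orbit T)"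
proof -
  \<comment> \<open>The matrices matter only for \<open>t \<noteq> 0\<close> and may have poles at
    0; continuity concerns the closed form \<open>f\<close> alone.\<close>
  have "f t \<in> GL_orbit T" if "t \<noteq> 0" for t
    using assms(3,4)[OF that] GL_orbit_mult[OF GL_orbit_self] by simp
  from closure_GL_orbit_subsetI[OF assms(1) this] show ?thesis
    using assms(2) by simp
qed

lemmas degeneration_simps =
  vec_eq_iff forall_2 sum_2 multilinear_mult_def unit_tensor_def invertible_mat22

lemma D0_le_D1: "closure D0 \<subseteq> closure D1"
  unfolding D0_def D1_def
  by (rule closure_GL_orbit_degeneration[where
        f = "\<lambda>t. t *\<^sub>R unit_tensor 1 1 1" and
        U = "\<lambda>t. mat22 t 0 0 1" and V = "\<lambda>t. mat22 1 0 0 1" and W = "\<lambda>t. mat22 1 0 0 1"])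
    (auto simp: degeneration_simps intro!: continuous_intros)

text \<open>Scaling the second basis vector of one mode by t damps the summand to be removed. The
  other edges into \<open>D2'\<close>, \<open>D2''\<close>, and those from them to
  \<open>D3\<close>, use the same device.\<close>

lemma D1_le_D2: "closure D1 \<subseteq> closure D2"
  unfolding D1_def D2_def
  by (rule closure_GL_orbit_degeneration[where
        f = "\<lambda>t. unit_tensor 1 1 1 + t *\<^sub>R unit_tensor 2 2 1" and
        U = "\<lambda>t. mat22 1 0 0 t" and V = "\<lambda>t. mat22 1 0 0 1" and W = "\<lambda>t. mat22 1 0 0 1"])
    (auto simp: degeneration_simps intro!: continuous_intros)

lemma D1_le_D2': "closure D1 \<subseteq> closure D2'"
  unfolding D1_def D2'_def
  by (rule closure_GL_orbit_degeneration[where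
        f = "\<lambda>t. unit_tensor 1 1 1 + t *\<^sub>R unit_tensor 1 2 2" and
        U = "\<lambda>t. mat22 1 0 0 1" and V = "\<lambda>t. mat22 1 0 0 t" and W = "\<lambda>t. mat22 1 0 0 1"])
    (auto simp: degeneration_simps intro!: continuous_intros)

lemma D1_le_D2'': "closure D1 \<subseteq> closure D2''"
  unfolding D1_def D2''_def
  by (rule closure_GL_orbit_degeneration[where
        f = "\<lambda>t. unit_tensor 1 1 1 + t *\<^sub>R unit_tensor 2 1 2" and
        U = "\<lambda>t. mat22 1 0 0 t" and V = "\<lambda>t. mat22 1 0 0 1" and W = "\<lambda>t. mat22 1 0 0 1"])
    (auto simp: degeneration_simps intro!: continuous_intros)

text \<open>Swapping the basis vectors in modes 1 and 3 turns the two summands of \<open>D3\<close>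
  with third index 2 into the form of \<open>D2\<close>. The factor t in \<open>W\<close> damps the
  remaining summand, moved to position (2,1,2).\<close>

lemma D2_le_D3: "closure D2 \<subseteq> closure D3"
  unfolding D2_def D3_def
  by (rule closure_GL_orbit_degeneration[where
        f = "\<lambda>t. unit_tensor 1 1 1 + unit_tensor 2 2 1 + t *\<^sub>R unit_tensor 2 1 2" and
        U = "\<lambda>t. mat22 0 1 1 0" and V = "\<lambda>t. mat22 1 0 0 1" and W = "\<lambda>t. mat22 0 1 t 0"])
    (auto simp: degeneration_simps intro!: continuous_intros)

lemma D2'_le_D3: "closure D2' \<subseteq> closure D3"
  unfolding D2'_def D3_def
  by (rule closure_GL_orbit_degeneration[where
        f = "\<lambda>t. unit_tensor 1 1 1 + unit_tensor 1 2 2 + t *\<^sub>R unit_tensor 2 1 2" and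
        U = "\<lambda>t. mat22 1 0 0 t" and V = "\<lambda>t. mat22 1 0 0 1" and W = "\<lambda>t. mat22 1 0 0 1"])
    (auto simp: degeneration_simps intro!: continuous_intros)

lemma D2''_le_D3: "closure D2'' \<subseteq> closure D3"
  unfolding D2''_def D3_def
  by (rule closure_GL_orbit_degeneration[where
        f = "\<lambda>t. unit_tensor 1 1 1 + unit_tensor 2 1 2 + t *\<^sub>R unit_tensor 1 2 2" and
        U = "\<lambda>t. mat22 1 0 0 1" and V = "\<lambda>t. mat22 1 0 0 t" and W = "\<lambda>t. mat22 1 0 0 1"])
    (auto simp: degeneration_simps intro!: continuous_intros)

text \<open>The family is \<open>((e\<^sub>1 + t e\<^sub>2)\<^sup>\<otimes>\<^sup>3 - e\<^sub>1\<^sup>\<otimes>\<^sup>3) / t\<close> with the basis vectors of the third mode swapped.\<close>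

lemma D3_le_G2: "closure D3 \<subseteq> closure G2"
  unfolding D3_def G2_def
  by (rule closure_GL_orbit_degeneration[where
        f = "\<lambda>t. unit_tensor 1 1 1 + unit_tensor 1 2 2 + unit_tensor 2 1 2
             + t *\<^sub>R (unit_tensor 1 2 1 + unit_tensor 2 1 1 + unit_tensor 2 2 2)
             + t\<^sup>2 *\<^sub>R unit_tensor 2 2 1" and
        U = "\<lambda>t. mat22 1 1 0 t" and V = "\<lambda>t. mat22 1 1 0 t" and
        W = "\<lambda>t. mat22 0 1 (-1/t) (1/t)"])
    (auto simp: degeneration_simps power2_eq_square intro!: continuous_intros)

text \<open>Diagonal matrices with first entries 1 and second entries u, v, w give the positions
  221, 122, 212 the coefficients uv, -vw, uw. Requiring vw = -1 and uw = 1 forces u = -v, and v = t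
  leaves uv = -t^2.\<close>

lemma D3_le_G3: "closure D3 \<subseteq> closure G3"
  unfolding D3_def G3_def
  by (rule closure_GL_orbit_degeneration[where
        f = "\<lambda>t. unit_tensor 1 1 1 + unit_tensor 1 2 2 + unit_tensor 2 1 2
             - t\<^sup>2 *\<^sub>R unit_tensor 2 2 1" and
        U = "\<lambda>t. mat22 1 0 0 (-t)" and V = "\<lambda>t. mat22 1 0 0 t" and
        W = "\<lambda>t. mat22 1 0 0 (-1/t)"])
    (auto simp: degeneration_simps power2_eq_square intro!: continuous_intros)

section \<open>Excluded relations and distinctness\<close>

lemma closure_GL_orbit_not_subsetI:
  assumes "(T = 0 \<and> S \<noteq> 0) \<or> (flat1 T \<and> \<not> flat1 S) \<or> (flat2 T \<and> \<not> flat2 S) \<or>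
    (flat3 T \<and> \<not> flat3 S) \<or> (0 \<le> hyperdet T \<and> hyperdet S < 0) \<or>
    (hyperdet T \<le> 0 \<and> 0 < hyperdet S)"
  shows "\<not> closure (GL_orbit S) \<subseteq> closure (GL_orbit T)"
  using closure_GL_orbit_subsetD[of S T] assms by fastforce

text \<open>These 32 pairs and the 24 pairs of \<open>hasse_edges_trancl\<close> exhaust the ordered
  pairs of different orbits, so later case splits are settled by simplification.\<close>

lemma not_degenerates:
  "\<not> closure D1 \<subseteq> closure D0" "\<not> closure D2 \<subseteq> closure D0"
  "\<not> closure D2' \<subseteq> closure D0" "\<not> closure D2'' \<subseteq> closure D0"
  "\<not> closure D3 \<subseteq> closure D0" "\<not> closure G2 \<subseteq> closure D0"
  "\<not> closure G3 \<subseteq> closure D0"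
  "\<not> closure D2 \<subseteq> closure D1" "\<not> closure D2' \<subseteq> closure D1"
  "\<not> closure D2'' \<subseteq> closure D1" "\<not> closure D3 \<subseteq> closure D1"
  "\<not> closure G2 \<subseteq> closure D1" "\<not> closure G3 \<subseteq> closure D1"
  "\<not> closure D2' \<subseteq> closure D2" "\<not> closure D2'' \<subseteq> closure D2"
  "\<not> closure D3 \<subseteq> closure D2" "\<not> closure G2 \<subseteq> closure D2"
  "\<not> closure G3 \<subseteq> closure D2"
  "\<not> closure D2 \<subseteq> closure D2'" "\<not> closure D2'' \<subseteq> closure D2'"
  "\<not> closure D3 \<subseteq> closure D2'" "\<not> closure G2 \<subseteq> closure D2'"
  "\<not> closure G3 \<subseteq> closure D2'"
  "\<not> closure D2 \<subseteq> closure D2''" "\<not> closure D2' \<subseteq> closure D2''"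
  "\<not> closure D3 \<subseteq> closure D2''" "\<not> closure G2 \<subseteq> closure D2''"
  "\<not> closure G3 \<subseteq> closure D2''"
  "\<not> closure G2 \<subseteq> closure D3" "\<not> closure G3 \<subseteq> closure D3"
  "\<not> closure G3 \<subseteq> closure G2"
  "\<not> closure G2 \<subseteq> closure G3"
  unfolding D0_def D1_def D2_def D2'_def D2''_def D3_def G2_def G3_def
  by (rule closure_GL_orbit_not_subsetI; simp)+

lemma distinct_orbits: "distinct [D0, D1, D2, D2', D2'', D3, G2, G3]"
proof -
  \<comment> \<open>For any two of the eight orbits at least one inclusion of closures is
    excluded.\<close>
  have "A \<noteq> B" if "\<not> closure A \<subseteq> closure B" for A B :: "tensor set"
    using that by blast
  from not_degenerates[THEN this] show ?thesis by simp
qed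

section \<open>The order and its Hasse diagram\<close>

lemma hasse_edges_subset_degen_order: "hasse_edges \<subseteq> degen_order"
  unfolding hasse_edges_def degen_order_def eight_orbits_def
  using D0_le_D1 D1_le_D2 D1_le_D2' D1_le_D2'' D2_le_D3 D2'_le_D3 D2''_le_D3 D3_le_G2 D3_le_G3
  by simp

lemma trans_degen_order: "trans degen_order"
  unfolding degen_order_def by (rule transI) auto

lemma trancl_hasse_edges_subset: "hasse_edges\<^sup>+ \<subseteq> degen_order"
proof
  fix p assume "p \<in> hasse_edges\<^sup>+"
  then have "p \<in> degen_order\<^sup>+"
    using hasse_edges_subset_degen_order by (rule trancl_mono)
  then show "p \<in> degen_order"
    by (simp only: trancl_id[OF trans_degen_order])
qed

lemma hasse_edges_trancl:
  "(D0, D1) \<in> hasse_edges\<^sup>+"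
  "B \<in> {D2, D2', D2''} \<Longrightarrow> (D1, B) \<in> hasse_edges\<^sup>+"
  "A \<in> {D2, D2', D2''} \<Longrightarrow> (A, D3) \<in> hasse_edges\<^sup>+"
  "B \<in> {G2, G3} \<Longrightarrow> (D3, B) \<in> hasse_edges\<^sup>+"
  "B \<in> {D2, D2', D2'', D3, G2, G3} \<Longrightarrow> (D0, B) \<in> hasse_edges\<^sup>+"
  "B \<in> {D3, G2, G3} \<Longrightarrow> (D1, B) \<in> hasse_edges\<^sup>+"
  "A \<in> {D2, D2', D2''} \<Longrightarrow> B \<in> {G2, G3} \<Longrightarrow> (A, B) \<in> hasse_edges\<^sup>+"
proof -
  show D0: "(D0, D1) \<in> hasse_edges\<^sup>+"
    and D1: "\<And>B. B \<in> {D2, D2', D2''} \<Longrightarrow> (D1, B) \<in> hasse_edges\<^sup>+"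
    and D2: "\<And>A. A \<in> {D2, D2', D2''} \<Longrightarrow> (A, D3) \<in> hasse_edges\<^sup>+"
    and D3: "\<And>B. B \<in> {G2, G3} \<Longrightarrow> (D3, B) \<in> hasse_edges\<^sup>+"
    by (rule r_into_trancl; auto simp: hasse_edges_def)+
  have D1_D3: "(D1, D3) \<in> hasse_edges\<^sup>+"
    using trancl_trans[OF D1[of D2] D2[of D2]] by simp
  show D1': "\<And>B. B \<in> {D3, G2, G3} \<Longrightarrow> (D1, B) \<in> hasse_edges\<^sup>+"
    by (elim insertE emptyE; simp add: D1_D3 trancl_trans[OF D1_D3 D3])
  show "\<And>B. B \<in> {D2, D2', D2'', D3, G2, G3} \<Longrightarrow> (D0, B) \<in> hasse_edges\<^sup>+"
    by (elim insertE emptyE; simp add: trancl_trans[OF D0 D1] trancl_trans[OF D0 D1'])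
  show "\<And>A B. A \<in> {D2, D2', D2''} \<Longrightarrow> B \<in> {G2, G3} \<Longrightarrow> (A, B) \<in> hasse_edges\<^sup>+"
    by (elim insertE emptyE; simp add: trancl_trans[OF D2 D3])
qed

lemma degen_order_iff:
  assumes "A \<in> eight_orbits" "B \<in> eight_orbits"
  shows "closure A \<subseteq> closure B \<longleftrightarrow> A = B \<or> (A, B) \<in> hasse_edges\<^sup>+"
proof
  assume "closure A \<subseteq> closure B"
  with assms show "A = B \<or> (A, B) \<in> hasse_edges\<^sup>+"
    unfolding eight_orbits_def
    by (elim insertE emptyE; simp add: not_degenerates hasse_edges_trancl)
next
  assume "A = B \<or> (A, B) \<in> hasse_edges\<^sup>+"
  then show "closure A \<subseteq> closure B"
    using trancl_hasse_edges_subset by (auto simp: degen_order_def)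
qed

lemma partial_order_degen_order: "partial_order_on eight_orbits degen_order"
proof -
  have "antisym degen_order"
  proof (rule antisymI)
    fix A B assume "(A, B) \<in> degen_order" "(B, A) \<in> degen_order"
    then have "A \<in> eight_orbits" "B \<in> eight_orbits"
      and "closure A \<subseteq> closure B" "closure B \<subseteq> closure A"
      by (auto simp: degen_order_def)
    then show "A = B"
      unfolding eight_orbits_def
      by (elim insertE emptyE; simp add: not_degenerates)
  qed
  then show ?thesis
    using trans_degen_order
    by (auto simp: partial_order_on_def preorder_on_def refl_on_def degen_order_def)
qed

lemma irrefl_hasse_edges: "(A, A) \<notin> hasse_edges"
proof
  assume "(A, A) \<in> hasse_edges"
  then show False
    unfolding hasse_edges_def
    by (elim insertE emptyE Pair_inject; hypsubst; use distinct_orbits in simp)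
qed

lemma covering_relations_degen_order: "covering_relations degen_order = hasse_edges"
proof (intro equalityI subrelI)
  fix A B assume AB: "(A, B) \<in> covering_relations degen_order"
  then have "A \<in> eight_orbits" "B \<in> eight_orbits" "closure A \<subseteq> closure B" "A \<noteq> B"
    by (simp_all add: covering_relations_def degen_order_def)
  then have "(A, B) \<in> hasse_edges\<^sup>+"
    by (simp add: degen_order_iff)
  then show "(A, B) \<in> hasse_edges"
  proof (cases rule: tranclE)
    \<comment> \<open>The last edge of the path runs from \<open>C\<close> to \<open>B\<close>.
      Nothing lies strictly between \<open>A\<close> and \<open>B\<close>, so \<open>C\<close> is
      \<open>A\<close> and this edge joins \<open>A\<close> to \<open>B\<close>.\<close>
    case (step C)
    have "(A, C) \<in> degen_order" "(C, B) \<in> degen_order"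
      using step hasse_edges_subset_degen_order trancl_hasse_edges_subset by blast+
    moreover have "C \<noteq> B"
      using step(2) irrefl_hasse_edges by blast
    ultimately have "A = C"
      using AB unfolding covering_relations_def by blast
    then show ?thesis using step(2) by simp
  qed
next
  fix A B assume AB: "(A, B) \<in> hasse_edges"
  then have "(A, B) \<in> degen_order"
    using hasse_edges_subset_degen_order by blast
  moreover have "A \<noteq> B"
    using AB irrefl_hasse_edges by blast
  \<comment> \<open>For every edge and every third orbit, \<open>not_degenerates\<close> excludes
    one of the two inclusions.\<close>
  moreover have "C = A \<or> C = B"
    if "C \<in> eight_orbits" "closure A \<subseteq> closure C" "closure C \<subseteq> closure B" for C
    using AB that unfolding hasse_edges_def eight_orbits_def
    by (elim insertE emptyE; simp add: not_degenerates)
  ultimately show "(A, B) \<in> covering_relations degen_order"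
    unfolding covering_relations_def degen_order_def by blast
qed

theorem theorem5p3:
  shows "distinct [D0, D1, D2, D2', D2'', D3, G2, G3]
    \<and> partial_order_on eight_orbits degen_order
    \<and> covering_relations degen_order = hasse_edges
    \<and> (\<forall>A\<in>eight_orbits. \<forall>B\<in>eight_orbits.
          closure A \<subseteq> closure B \<longleftrightarrow> A = B \<or> (A, B) \<in> hasse_edges\<^sup>+)"
  by (intro conjI ballI distinct_orbits partial_order_degen_order
      covering_relations_degen_order degen_order_iff)

end
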